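(* Let $m, d \geq 1$ be integers and let $\Omega = [d]=\{1,\dots,d\}$. (1) If $\mathfrak{S}$ is a set association scheme on $\Omega$, then $\mathfrak{X} = [m]^{\mathfrak{S}}$ is an association scheme such that $\mathcal{T}_m^d \leq \mathfrak{X} \leq \mathcal{H}(d,m)$. (2) Conversely, there is $m_0(d)$ such that if $\mathfrak{X}$ is an association scheme with $\mathcal{T}_m^d \leq \mathfrak{X} \leq \mathcal{H}(d,m)$ and $m \geq m_0(d)$, then $\mathfrak{X} = [m]^{\mathfrak{S}}$ for some set association scheme $\mathfrak{S}$ on $\Omega$. One can take $m_0(d) = 3^d + 4$.
   Context: Coherent configurations. A configuration $\mathfrak{X}$ on a finite set $V$ is a partition of $V^2$ into nonempty relations $R_1,\dots,R_r$ such that some subset of $\mathfrak{X}$ partitions the diagonal, and $R\in\mathfrak{X}$ implies $R^*=\{(x,y):(y,x)\in R\}\in\mathfrak{X}$. It is coherent if there are constants $p^i_{jk}$ such that for all $i,j,k$ and $(u,v)\in R_i$, $\#\{w\in V:(u,w)\in R_j,(w,v)\in R_k\}=p^i_{jk}$. An association scheme is a coherent configuration in which the diagonal is a relation and every relation is symmetric. For partitions of the same set, $\pi\leq\pi'$ means every cell of $\pi$ is contained in a cell of $\pi'$. $\mathcal{T}_m^d$ is the configuration on $[m]^d$ in which the relation containing $(u,v)$ is determined by the set $\{i:u_i\neq v_i\}$ (the $d$th tensor power of the trivial scheme). $\mathcal{H}(d,m)$, the Hamming scheme, is the configuration on $[m]^d$ in which the relation containing $(u,v)$ is determined by the Hamming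 distance $|\{i:u_i\neq v_i\}|$. Set association schemes. Let $\Omega$ be a finite set and $2^\Omega$ its power set. The type of a triple $(a,b,c)\in(2^\Omega)^3$ is its orbit under $\operatorname{Sym}(\Omega)$; equivalently it is determined by $(|a|,|b|,|c|,|a\cap b|,|a\cap c|,|b\cap c|,|a\cap b\cap c|)$. A triple $(a,b,c)$ is a triangle if $a\subseteq b\cup c$, $b\subseteq a\cup c$ and $c\subseteq a\cup b$; the type of a triangle is a triangle type. A partition $\mathfrak{S}$ of $2^\Omega$ is coherent with respect to a type $\tau$ if for all $\alpha,\beta,\gamma\in\mathfrak{S}$ the number $\#\{(b,c)\in\beta\times\gamma:(a,b,c)\in\tau\}$ is the same for all $a\in\alpha$. A set association scheme on $\Omega$ is a partition $\mathfrak{S}$ of $2^\Omega$ such that (i) any two sets in the same cell have the same cardinality, and (ii) $\mathfrak{S}$ is coherent with respect to all triangle types. For a partition $\mathfrak{S}$ of $2^\Omega$ and $m\geq1$, $[m]^{\mathfrak{S}}$ denotes the partition of $V^2$, $V=[m]^\Omega$, into the (nonempty) relations $R_\alpha$ ($\alpha\in\mathfrak{S}$), where $(u,v)\in R_\alpha\iff\{i:u_i\neq v_i\}\in\alpha$. *)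

theory Defs
  imports Main "HOL-Library.Disjoint_Sets" "HOL-Library.FuncSet" "HOL-Combinatorics.Permutations"
begin

definition configuration :: "'v set \<Rightarrow> 'v rel set \<Rightarrow> bool" where
  "configuration V \<XX> \<longleftrightarrow>
     finite V \<and> partition_on (V \<times> V) \<XX> \<and>
     (\<exists>\<DD>\<subseteq>\<XX>. partition_on (Id_on V) \<DD>) \<and>
     (\<forall>R\<in>\<XX>. R\<inverse> \<in> \<XX>)"

definition coherent_configuration :: "'v set \<Rightarrow> 'v rel set \<Rightarrow> bool" where
  "coherent_configuration V \<XX> \<longleftrightarrow>
     configuration V \<XX> \<and>
     (\<forall>R\<in>\<XX>. \<forall>S\<in>\<XX>. \<forall>T\<in>\<XX>. \<exists>p. \<forall>(u, v)\<in>R.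
        card {w \<in> V. (u, w) \<in> S \<and> (w, v) \<in> T} = p)"

definition association_scheme :: "'v set \<Rightarrow> 'v rel set \<Rightarrow> bool" where
  "association_scheme V \<XX> \<longleftrightarrow>
     coherent_configuration V \<XX> \<and> Id_on V \<in> \<XX> \<and> (\<forall>R\<in>\<XX>. sym R)"

text \<open>Words are extensional functions, so that two words that agree on \<open>\<Omega>\<close> are equal.\<close>

definition words :: "nat \<Rightarrow> 'a set \<Rightarrow> ('a \<Rightarrow> nat) set" where
  "words m \<Omega> = (\<Pi>\<^sub>E i\<in>\<Omega>. {1..m})"

definition diff_set :: "'a set \<Rightarrow> ('a \<Rightarrow> nat) \<Rightarrow> ('a \<Rightarrow> nat) \<Rightarrow> 'a set" where
  "diff_set \<Omega> u v = {i \<in> \<Omega>. u i \<noteq> v i}"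

definition fibers :: "'b set \<Rightarrow> ('b \<Rightarrow> 'c) \<Rightarrow> 'b set set" where
  "fibers A f = (\<lambda>x. {y \<in> A. f y = f x}) ` A"

definition trivial_power :: "nat \<Rightarrow> nat \<Rightarrow> (nat \<Rightarrow> nat) rel set" where
  "trivial_power m d =
     fibers (words m {1..d} \<times> words m {1..d}) (\<lambda>(u, v). diff_set {1..d} u v)"

definition hamming_scheme :: "nat \<Rightarrow> nat \<Rightarrow> (nat \<Rightarrow> nat) rel set" where
  "hamming_scheme d m =
     fibers (words m {1..d} \<times> words m {1..d}) (\<lambda>(u, v). card (diff_set {1..d} u v))"

definition triple_type :: "'a set \<Rightarrow> 'a set \<times> 'a set \<times> 'a set \<Rightarrow> ('a set \<times> 'a set \<times> 'a set) set" where
  "triple_type \<Omega> = (\<lambda>(a, b, c). {(\<pi> ` a, \<pi> ` b, \<pi> ` c) | \<pi>. \<pi> permutes \<Omega>})"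

definition triangle :: "'a set \<Rightarrow> 'a set \<Rightarrow> 'a set \<Rightarrow> bool" where
  "triangle a b c \<longleftrightarrow> a \<subseteq> b \<union> c \<and> b \<subseteq> a \<union> c \<and> c \<subseteq> a \<union> b"

definition triangle_types :: "'a set \<Rightarrow> ('a set \<times> 'a set \<times> 'a set) set set" where
  "triangle_types \<Omega> =
     {triple_type \<Omega> (a, b, c) | a b c. a \<subseteq> \<Omega> \<and> b \<subseteq> \<Omega> \<and> c \<subseteq> \<Omega> \<and> triangle a b c}"

definition coherent_wrt :: "'a set set set \<Rightarrow> ('a set \<times> 'a set \<times> 'a set) set \<Rightarrow> bool" where
  "coherent_wrt \<SS> \<tau> \<longleftrightarrow>
     (\<forall>\<alpha>\<in>\<SS>. \<forall>\<beta>\<in>\<SS>. \<forall>\<gamma>\<in>\<SS>. \<exists>p. \<forall>a\<in>\<alpha>.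
        card {(b, c) \<in> \<beta> \<times> \<gamma>. (a, b, c) \<in> \<tau>} = p)"

definition set_association_scheme :: "'a set \<Rightarrow> 'a set set set \<Rightarrow> bool" where
  "set_association_scheme \<Omega> \<SS> \<longleftrightarrow>
     finite \<Omega> \<and> partition_on (Pow \<Omega>) \<SS> \<and>
     (\<forall>\<alpha>\<in>\<SS>. \<forall>a\<in>\<alpha>. \<forall>b\<in>\<alpha>. card a = card b) \<and>
     (\<forall>\<tau>\<in>triangle_types \<Omega>. coherent_wrt \<SS> \<tau>)"

text \<open>The empty relation is removed: for \<open>m = 1\<close> every cell not containing \<open>{}\<close> gives the
  empty relation.\<close>

definition word_partition :: "nat \<Rightarrow> 'a set \<Rightarrow> 'a set set set \<Rightarrow> ('a \<Rightarrow> nat) rel set" where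
  "word_partition m \<Omega> \<SS> =
     (\<lambda>\<alpha>. {(u, v) \<in> words m \<Omega> \<times> words m \<Omega>. diff_set \<Omega> u v \<in> \<alpha>}) ` \<SS> - {{}}"

end

theory Submission
  imports Defs
begin

text \<open>
  Both directions rest on one formula. Fix words \<open>u, v\<close> that differ exactly on \<open>a\<close>. The words \<open>w\<close>
  that differ from \<open>u\<close> exactly on \<open>b\<close> and from \<open>v\<close> exactly on \<open>c\<close> can be chosen letter by letter.
  There are none unless \<open>(a, b, c)\<close> is a triangle, and then there are
  \[ (m-1)^{|b \cap c - a|} (m-2)^{|a \cap b \cap c|} \]
  of them (\<open>card_intermediate_words\<close>). So the intersection number of three relations indexed by
  cells \<open>\<alpha>, \<beta>, \<gamma>\<close> is a weighted count of the triangles in \<open>{a} \<times> \<beta> \<times> \<gamma>\<close>.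

  Once \<open>|a|\<close>, \<open>|b|\<close>, \<open>|c|\<close> are known, the type of a triangle has one degree of freedom, the number
  \<open>x = |b \<inter> c - a|\<close>; in particular \<open>|a \<inter> b \<inter> c| = K - 2 * x\<close> where \<open>K = |b| + |c| - |a|\<close>. As the
  sets in a cell have the same size, coherence with respect to all triangle types says that
  the number \<open>N a x\<close> of triangles with parameter \<open>x\<close> is the same for all \<open>a \<in> \<alpha>\<close>
  (\<open>coherent_wrt_triangle_types_iff\<close>), while coherence of the configuration on words says that
  \[ \sum_x N(a,x) (m-1)^x (m-2)^{K-2x} \]
  is (\<open>card_two_step_words\<close>). The first property clearly implies the second.

  For the converse, the sum has to determine its coefficients. This holds for large \<open>m\<close>: if two
  such sums agree and \<open>D x\<close> are the differences of the coefficients, then, \<open>m - 1\<close> and \<open>m - 2\<close> being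
  coprime, \<open>m - 1\<close> divides \<open>D 0\<close>; but \<open>|D 0| \<le> 3^d < m - 1\<close>, as there are at most three ways
  to place each point in \<open>b\<close> and \<open>c\<close>. So \<open>D 0 = 0\<close>, and a factor \<open>m - 1\<close> cancels
  (\<open>small_coefficients_vanish\<close>). That a scheme coarser than the tensor power of the trivial scheme
  comes from a partition of the power set at all only needs every set to be a difference set
  (\<open>refined_scheme_eq_word_partition\<close>).
\<close>

section \<open>Counting intermediate words\<close>

definition word_relation :: "nat \<Rightarrow> 'a set \<Rightarrow> 'a set set \<Rightarrow> ('a \<Rightarrow> nat) rel" where
  "word_relation m \<Omega> \<alpha> = {(u, v) \<in> words m \<Omega> \<times> words m \<Omega>. diff_set \<Omega> u v \<in> \<alpha>}"

lemma word_partition_eq: "word_partition m \<Omega> \<SS> = word_relation m \<Omega> ` \<SS> - {{}}"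
  by (simp add: word_partition_def word_relation_def)

lemma finite_words: "finite \<Omega> \<Longrightarrow> finite (words m \<Omega>)"
  by (simp add: words_def finite_PiE)

lemma diff_set_subset: "diff_set \<Omega> u v \<subseteq> \<Omega>"
  by (auto simp: diff_set_def)

lemma diff_set_commute: "diff_set \<Omega> u v = diff_set \<Omega> v u"
  by (auto simp: diff_set_def)

lemma diff_set_eq_iff:
  "b \<subseteq> \<Omega> \<Longrightarrow> diff_set \<Omega> u v = b \<longleftrightarrow> (\<forall>i\<in>\<Omega>. u i \<noteq> v i \<longleftrightarrow> i \<in> b)"
  unfolding diff_set_def by blast

lemma diff_set_empty_iff:
  assumes "u \<in> words m \<Omega>" "v \<in> words m \<Omega>"
  shows "diff_set \<Omega> u v = {} \<longleftrightarrow> u = v"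
proof
  assume "diff_set \<Omega> u v = {}"
  then show "u = v"
    using assms by (auto simp: diff_set_def words_def intro: PiE_ext)
qed (simp add: diff_set_def)

lemma words_nonempty: "m \<ge> 1 \<Longrightarrow> words m \<Omega> \<noteq> {}"
  by (auto simp: words_def PiE_eq_empty_iff)

lemma exists_words_with_diff_set:
  assumes "m \<ge> 2" "a \<subseteq> \<Omega>"
  obtains u v where "u \<in> words m \<Omega>" "v \<in> words m \<Omega>" "diff_set \<Omega> u v = a"
proof
  show "(\<lambda>i\<in>\<Omega>. 1) \<in> words m \<Omega>" "(\<lambda>i\<in>\<Omega>. if i \<in> a then 2 else 1) \<in> words m \<Omega>"
    using assms by (auto simp: words_def)
  show "diff_set \<Omega> (\<lambda>i\<in>\<Omega>. 1) (\<lambda>i\<in>\<Omega>. if i \<in> a then 2 else 1) = a"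
    using assms by (auto simp: diff_set_def split: if_splits)
qed

lemma prod_if_eq_power:
  assumes "finite \<Omega>" "B \<subseteq> \<Omega>"
  shows "(\<Prod>i\<in>\<Omega>. if i \<in> B then x else (1::nat)) = x ^ card B"
proof -
  have "(\<Prod>i\<in>\<Omega>. if i \<in> B then x else (1::nat)) = (\<Prod>i\<in>\<Omega> \<inter> B. x)"
    using prod.inter_restrict[OF assms(1), of "\<lambda>_. x" B] by simp
  also have "\<Omega> \<inter> B = B"
    using assms by auto
  finally show ?thesis
    by simp
qed

text \<open>
  The conditions on \<open>w\<close> constrain its letters independently. At a point outside \<open>a\<close>, where \<open>u\<close> and
  \<open>v\<close> agree, \<open>w\<close> differs from both (\<open>m - 1\<close> letters) or from neither (one letter). At a point of
  \<open>a\<close>, \<open>w\<close> differs from both (\<open>m - 2\<close> letters) or agrees with exactly one (one letter). The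
  combinations left out are those forbidden in a triangle. The truncated subtraction in \<open>m - 2\<close> is
  harmless: if \<open>m = 1\<close> then \<open>a\<close> is empty, so its power is \<open>1\<close>.
\<close>
lemma card_intermediate_words:
  assumes fin: "finite \<Omega>" and u: "u \<in> words m \<Omega>" and v: "v \<in> words m \<Omega>"
    and b: "b \<subseteq> \<Omega>" and c: "c \<subseteq> \<Omega>"
  defines "a \<equiv> diff_set \<Omega> u v"
  shows "card {w \<in> words m \<Omega>. diff_set \<Omega> u w = b \<and> diff_set \<Omega> w v = c} =
    (if triangle a b c then (m - 1) ^ card (b \<inter> c - a) * (m - 2) ^ card (a \<inter> b \<inter> c) else 0)"
proof -
  define L where "L i = {x \<in> {1..m}. (u i \<noteq> x \<longleftrightarrow> i \<in> b) \<and> (x \<noteq> v i \<longleftrightarrow> i \<in> c)}" for i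
  have "{w \<in> words m \<Omega>. diff_set \<Omega> u w = b \<and> diff_set \<Omega> w v = c} = Pi\<^sub>E \<Omega> L"
    using b c by (auto simp: words_def diff_set_eq_iff L_def PiE_iff extensional_def)
  then have card_eq: "card {w \<in> words m \<Omega>. diff_set \<Omega> u w = b \<and> diff_set \<Omega> w v = c} = (\<Prod>i\<in>\<Omega>. card (L i))"
    using fin by (simp add: card_PiE)
  have ui: "u i \<in> {1..m}" and vi: "v i \<in> {1..m}" if "i \<in> \<Omega>" for i
    using u v that by (auto simp: words_def)
  have ia: "i \<in> a \<longleftrightarrow> u i \<noteq> v i" if "i \<in> \<Omega>" for i
    using that by (auto simp: a_def diff_set_def)
  show ?thesis
  proof (cases "triangle a b c")
    case True
    have L: "card (L i) = (if i \<in> b \<inter> c - a then m - 1 else 1) * (if i \<in> a \<inter> b \<inter> c then m - 2 else 1)"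
      if i: "i \<in> \<Omega>" for i
    proof -
      consider "i \<in> b" "i \<in> c" "i \<in> a" | "i \<in> b" "i \<in> c" "i \<notin> a"
        | "i \<notin> b" "i \<notin> c" "i \<notin> a" | "i \<in> b" "i \<notin> c" "i \<in> a" | "i \<notin> b" "i \<in> c" "i \<in> a"
        using True by (auto simp: triangle_def)
      then show ?thesis
      proof cases
        case 1
        then have "L i = {1..m} - {u i, v i}"
          by (auto simp: L_def)
        moreover have "card ({1..m} - {u i, v i}) = m - 2"
          using 1 ia[OF i] ui[OF i] vi[OF i] by (subst card_Diff_subset) auto
        ultimately show ?thesis
          using 1 by simp
      next
        case 2
        then have "L i = {1..m} - {u i}"
          using ia[OF i] by (auto simp: L_def)
        then show ?thesis
          using 2 ui[OF i] by simp
      next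
        case 3
        then have "L i = {u i}"
          using ia[OF i] ui[OF i] by (auto simp: L_def)
        then show ?thesis
          using 3 by simp
      next
        case 4
        then have "L i = {v i}"
          using ia[OF i] vi[OF i] by (auto simp: L_def)
        then show ?thesis
          using 4 by simp
      next
        case 5
        then have "L i = {u i}"
          using ia[OF i] ui[OF i] by (auto simp: L_def)
        then show ?thesis
          using 5 by simp
      qed
    qed
    have "b \<inter> c - a \<subseteq> \<Omega>" "a \<inter> b \<inter> c \<subseteq> \<Omega>"
      using b by auto
    then have "(\<Prod>i\<in>\<Omega>. card (L i)) = (m - 1) ^ card (b \<inter> c - a) * (m - 2) ^ card (a \<inter> b \<inter> c)"
      using fin by (simp only: L prod.distrib prod_if_eq_power cong: prod.cong)
    then show ?thesis
      using True card_eq by simp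
  next
    case False
    have "a \<subseteq> \<Omega>"
      by (simp add: a_def diff_set_subset)
    then obtain i where i: "i \<in> \<Omega>"
      and "i \<in> a \<and> i \<notin> b \<and> i \<notin> c \<or> i \<notin> a \<and> i \<in> b \<and> i \<notin> c \<or> i \<notin> a \<and> i \<notin> b \<and> i \<in> c"
      using False b c unfolding triangle_def by blast
    then have "L i = {}"
      using ia[OF i] by (auto simp: L_def)
    then have "card (L i) = 0"
      by simp
    then have "(\<Prod>i\<in>\<Omega>. card (L i)) = 0"
      using i fin by (meson prod_zero)
    then show ?thesis
      using False card_eq by simp
  qed
qed

section \<open>Types of triangles\<close>

lemma card_disjoint_Un3:
  assumes "finite p" "finite q" "finite r" "p \<inter> q = {}" "p \<inter> r = {}" "q \<inter> r = {}"
  shows "card (p \<union> q \<union> r) = card p + card q + card r"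
  using assms by (subst card_Un_disjoint) (auto simp: card_Un_disjoint)

text \<open>
  In a triangle every point of the union lies in at least two of the sets. So the union splits into
  the triple intersection and three parts, each contained in exactly two sets; these parts are
  \<open>b \<inter> c - a\<close>, \<open>a - c\<close> and \<open>a - b\<close>.
\<close>
lemma card_triangle_sides:
  assumes "finite a" "finite b" "finite c" "triangle a b c"
  shows "card a = card (a \<inter> b \<inter> c) + card (a - c) + card (a - b)"
    and "card b = card (a \<inter> b \<inter> c) + card (b \<inter> c - a) + card (a - c)"
    and "card c = card (a \<inter> b \<inter> c) + card (b \<inter> c - a) + card (a - b)"
proof -
  have "a = (a \<inter> b \<inter> c) \<union> (a - c) \<union> (a - b)"
    and "b = (a \<inter> b \<inter> c) \<union> (b \<inter> c - a) \<union> (a - c)"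
    and "c = (a \<inter> b \<inter> c) \<union> (b \<inter> c - a) \<union> (a - b)"
    using assms(4) by (auto simp: triangle_def)
  moreover have "card ((a \<inter> b \<inter> c) \<union> (a - c) \<union> (a - b)) = card (a \<inter> b \<inter> c) + card (a - c) + card (a - b)"
    "card ((a \<inter> b \<inter> c) \<union> (b \<inter> c - a) \<union> (a - c)) = card (a \<inter> b \<inter> c) + card (b \<inter> c - a) + card (a - c)"
    "card ((a \<inter> b \<inter> c) \<union> (b \<inter> c - a) \<union> (a - b)) = card (a \<inter> b \<inter> c) + card (b \<inter> c - a) + card (a - b)"
    using assms by (intro card_disjoint_Un3; auto simp: triangle_def)+
  ultimately show "card a = card (a \<inter> b \<inter> c) + card (a - c) + card (a - b)"
    and "card b = card (a \<inter> b \<inter> c) + card (b \<inter> c - a) + card (a - c)"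
    and "card c = card (a \<inter> b \<inter> c) + card (b \<inter> c - a) + card (a - b)"
    by simp_all
qed

text \<open>
  The three equations for the sides have four unknowns, so the sizes of \<open>a\<close>, \<open>b\<close>, \<open>c\<close> and of one
  part give the sizes of all parts, hence the type.
\<close>
lemma triple_type_triangle_iff:
  assumes fin: "finite \<Omega>"
    and sub: "a \<subseteq> \<Omega>" "b \<subseteq> \<Omega>" "c \<subseteq> \<Omega>" and sub': "a' \<subseteq> \<Omega>" "b' \<subseteq> \<Omega>" "c' \<subseteq> \<Omega>"
    and tri: "triangle a b c"
  shows "(a', b', c') \<in> triple_type \<Omega> (a, b, c) \<longleftrightarrow>
    triangle a' b' c' \<and> card a' = card a \<and> card b' = card b \<and> card c' = card c \<and>
    card (b' \<inter> c' - a') = card (b \<inter> c - a)"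
    (is "?T \<longleftrightarrow> ?C")
proof
  assume ?T
  then obtain \<pi> where \<pi>: "\<pi> permutes \<Omega>" and eq: "a' = \<pi> ` a" "b' = \<pi> ` b" "c' = \<pi> ` c"
    by (auto simp: triple_type_def)
  have inj: "inj \<pi>"
    using \<pi> by (rule permutes_inj)
  then have "b' \<inter> c' - a' = \<pi> ` (b \<inter> c - a)"
    by (simp add: eq image_Int image_set_diff)
  moreover have "triangle a' b' c'"
    using tri by (auto simp: triangle_def eq)
  ultimately show ?C
    using inj by (simp add: eq card_image inj_on_subset)
next
  assume C: ?C
  note fins = finite_subset[OF sub(1) fin] finite_subset[OF sub(2) fin] finite_subset[OF sub(3) fin]
  note fins' = finite_subset[OF sub'(1) fin] finite_subset[OF sub'(2) fin] finite_subset[OF sub'(3) fin]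
  have tri': "triangle a' b' c'"
    using C by simp
  note sides = card_triangle_sides[OF fins tri] card_triangle_sides[OF fins' tri']
  have p: "card (a' \<inter> b' \<inter> c') = card (a \<inter> b \<inter> c)" and q: "card (b' \<inter> c' - a') = card (b \<inter> c - a)"
    and s: "card (a' - c') = card (a - c)" and t: "card (a' - b') = card (a - b)"
    using C sides by linarith+
  have outside: "card (\<Omega> - (x \<union> y \<union> z)) = card \<Omega> - (card x + card (y \<inter> z - x))"
    if "x \<subseteq> \<Omega>" "y \<subseteq> \<Omega>" "z \<subseteq> \<Omega>" "triangle x y z" for x y z
  proof -
    have "x \<union> y \<union> z = x \<union> (y \<inter> z - x)"
      using that by (auto simp: triangle_def)
    also have "card \<dots> = card x + card (y \<inter> z - x)"
      using that fin by (intro card_Un_disjoint) (auto intro: finite_subset)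
    finally show ?thesis
      using that fin by (subst card_Diff_subset) (auto intro: finite_subset)
  qed
  have out: "card (\<Omega> - (a' \<union> b' \<union> c')) = card (\<Omega> - (a \<union> b \<union> c))"
    using outside[OF sub tri] outside[OF sub' tri'] C by simp
  \<comment> \<open>Two colourings of \<open>\<Omega>\<close> whose colour classes have equal sizes differ by a permutation.\<close>
  define colour where "colour x y z i = (i \<in> x, i \<in> y, i \<in> z)" for x y z :: "'a set" and i
  have fibre: "{i \<in> \<Omega>. colour x y z i = k} =
      (if k = (True, True, True) then x \<inter> y \<inter> z
       else if k = (False, True, True) then y \<inter> z - x
       else if k = (True, True, False) then x - z
       else if k = (True, False, True) then x - y
       else if k = (False, False, False) then \<Omega> - (x \<union> y \<union> z) else {})"
    if "x \<subseteq> \<Omega>" "y \<subseteq> \<Omega>" "z \<subseteq> \<Omega>" "triangle x y z" for x y z k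
    using that by (cases k) (auto simp: triangle_def colour_def)
  have "image_mset (colour a b c) (mset_set \<Omega>) = image_mset (colour a' b' c') (mset_set \<Omega>)"
  proof (rule multiset_eqI)
    fix k
    have "card {i \<in> \<Omega>. colour a b c i = k} = card {i \<in> \<Omega>. colour a' b' c' i = k}"
      unfolding fibre[OF sub tri] fibre[OF sub' tri'] using p q s t out by simp
    then show "count (image_mset (colour a b c) (mset_set \<Omega>)) k
        = count (image_mset (colour a' b' c') (mset_set \<Omega>)) k"
      using fin by (simp add: count_image_mset_eq_card_vimage)
  qed
  then obtain \<pi> where \<pi>: "\<pi> permutes \<Omega>" and eq: "\<forall>i\<in>\<Omega>. colour a b c i = colour a' b' c' (\<pi> i)"
    using image_mset_eq_implies_permutes[OF fin] by metis
  have img: "y = \<pi> ` x" if "x \<subseteq> \<Omega>" "y \<subseteq> \<Omega>" "\<forall>i\<in>\<Omega>. i \<in> x \<longleftrightarrow> \<pi> i \<in> y" for x y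
  proof -
    have "y \<subseteq> \<pi> ` \<Omega>"
      using that(2) permutes_image[OF \<pi>] by simp
    then show ?thesis
      using that by blast
  qed
  have "a' = \<pi> ` a" "b' = \<pi> ` b" "c' = \<pi> ` c"
    using eq sub sub' by (simp_all add: colour_def img)
  then show ?T
    using \<pi> by (auto simp: triple_type_def)
qed

definition triangle_pairs :: "'a set set \<Rightarrow> 'a set set \<Rightarrow> 'a set \<Rightarrow> nat \<Rightarrow> ('a set \<times> 'a set) set" where
  "triangle_pairs \<beta> \<gamma> a x = {(b, c) \<in> \<beta> \<times> \<gamma>. triangle a b c \<and> card (b \<inter> c - a) = x}"

text \<open>
  For a triangle \<open>(a\<^sub>0, b\<^sub>0, c\<^sub>0)\<close> whose sides have the sizes that occur in three given cells, the
  triples of its type in these cells are the triangles with the same value of \<open>|b \<inter> c - a|\<close>. If the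
  sizes do not match, or no triangle has the value \<open>x\<close>, the count in question is constantly zero.
\<close>
lemma coherent_wrt_triangle_types_iff:
  assumes fin: "finite \<Omega>" and sub: "\<And>\<alpha>. \<alpha> \<in> \<SS> \<Longrightarrow> \<alpha> \<subseteq> Pow \<Omega>"
    and unif: "\<forall>\<alpha>\<in>\<SS>. \<forall>a\<in>\<alpha>. \<forall>b\<in>\<alpha>. card a = card b"
  shows "(\<forall>\<tau>\<in>triangle_types \<Omega>. coherent_wrt \<SS> \<tau>) \<longleftrightarrow>
    (\<forall>\<alpha>\<in>\<SS>. \<forall>\<beta>\<in>\<SS>. \<forall>\<gamma>\<in>\<SS>. \<forall>x. \<exists>p. \<forall>a\<in>\<alpha>. card (triangle_pairs \<beta> \<gamma> a x) = p)"
    (is "?L \<longleftrightarrow> ?R")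
proof -
  have pairs_eq: "{(b, c) \<in> \<beta> \<times> \<gamma>. (a, b, c) \<in> triple_type \<Omega> (a\<^sub>0, b\<^sub>0, c\<^sub>0)}
      = triangle_pairs \<beta> \<gamma> a (card (b\<^sub>0 \<inter> c\<^sub>0 - a\<^sub>0))"
    if sub0: "a\<^sub>0 \<subseteq> \<Omega>" "b\<^sub>0 \<subseteq> \<Omega>" "c\<^sub>0 \<subseteq> \<Omega>" and tri: "triangle a\<^sub>0 b\<^sub>0 c\<^sub>0"
      and a: "a \<subseteq> \<Omega>" "card a = card a\<^sub>0"
      and \<beta>: "\<beta> \<subseteq> Pow \<Omega>" "\<forall>b\<in>\<beta>. card b = card b\<^sub>0"
      and \<gamma>: "\<gamma> \<subseteq> Pow \<Omega>" "\<forall>c\<in>\<gamma>. card c = card c\<^sub>0"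
    for \<beta> \<gamma> a a\<^sub>0 b\<^sub>0 c\<^sub>0
  proof -
    have "(a, b, c) \<in> triple_type \<Omega> (a\<^sub>0, b\<^sub>0, c\<^sub>0) \<longleftrightarrow>
        triangle a b c \<and> card (b \<inter> c - a) = card (b\<^sub>0 \<inter> c\<^sub>0 - a\<^sub>0)"
      if bc: "b \<in> \<beta>" "c \<in> \<gamma>" for b c
    proof -
      have "b \<subseteq> \<Omega>" "c \<subseteq> \<Omega>"
        using bc \<beta>(1) \<gamma>(1) by blast+
      from triple_type_triangle_iff[OF fin sub0 a(1) this tri] show ?thesis
        using bc a(2) \<beta>(2) \<gamma>(2) by simp
    qed
    then show ?thesis
      by (auto simp: triangle_pairs_def)
  qed
  have cell_card: "\<forall>a'\<in>\<alpha>. card a' = k" if "\<alpha> \<in> \<SS>" "a \<in> \<alpha>" "card a = k" for \<alpha> a k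
    using unif that by blast
  show ?thesis
  proof (intro iffI ballI allI)
    fix \<alpha> \<beta> \<gamma> x
    assume L: ?L and cells: "\<alpha> \<in> \<SS>" "\<beta> \<in> \<SS>" "\<gamma> \<in> \<SS>"
    show "\<exists>p. \<forall>a\<in>\<alpha>. card (triangle_pairs \<beta> \<gamma> a x) = p"
    proof (cases "\<exists>a\<in>\<alpha>. triangle_pairs \<beta> \<gamma> a x \<noteq> {}")
      case True
      then obtain a\<^sub>0 b\<^sub>0 c\<^sub>0 where in0: "a\<^sub>0 \<in> \<alpha>" "b\<^sub>0 \<in> \<beta>" "c\<^sub>0 \<in> \<gamma>" and tri: "triangle a\<^sub>0 b\<^sub>0 c\<^sub>0"
        and x: "x = card (b\<^sub>0 \<inter> c\<^sub>0 - a\<^sub>0)"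
        by (auto simp: triangle_pairs_def)
      have sub0: "a\<^sub>0 \<subseteq> \<Omega>" "b\<^sub>0 \<subseteq> \<Omega>" "c\<^sub>0 \<subseteq> \<Omega>"
        using in0 cells sub by blast+
      have "triple_type \<Omega> (a\<^sub>0, b\<^sub>0, c\<^sub>0) \<in> triangle_types \<Omega>"
        using sub0 tri by (auto simp: triangle_types_def)
      with L cells obtain p where
        "\<forall>a\<in>\<alpha>. card {(b, c) \<in> \<beta> \<times> \<gamma>. (a, b, c) \<in> triple_type \<Omega> (a\<^sub>0, b\<^sub>0, c\<^sub>0)} = p"
        unfolding coherent_wrt_def by meson
      moreover have "{(b, c) \<in> \<beta> \<times> \<gamma>. (a, b, c) \<in> triple_type \<Omega> (a\<^sub>0, b\<^sub>0, c\<^sub>0)}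
          = triangle_pairs \<beta> \<gamma> a x" if "a \<in> \<alpha>" for a
        unfolding x
      proof (rule pairs_eq[OF sub0 tri])
        show "a \<subseteq> \<Omega>" "\<beta> \<subseteq> Pow \<Omega>" "\<gamma> \<subseteq> Pow \<Omega>"
          using sub cells that by blast+
        show "card a = card a\<^sub>0" "\<forall>b\<in>\<beta>. card b = card b\<^sub>0" "\<forall>c\<in>\<gamma>. card c = card c\<^sub>0"
          using cell_card[OF cells(1) in0(1) refl] cell_card[OF cells(2) in0(2) refl]
            cell_card[OF cells(3) in0(3) refl] that by simp_all
      qed
      ultimately show ?thesis
        by auto
    next
      case False
      then show ?thesis
        by (intro exI[of _ 0]) auto
    qed
  next
    fix \<tau>
    assume R: ?R and "\<tau> \<in> triangle_types \<Omega>"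
    then obtain a\<^sub>0 b\<^sub>0 c\<^sub>0 where \<tau>: "\<tau> = triple_type \<Omega> (a\<^sub>0, b\<^sub>0, c\<^sub>0)"
      and sub0: "a\<^sub>0 \<subseteq> \<Omega>" "b\<^sub>0 \<subseteq> \<Omega>" "c\<^sub>0 \<subseteq> \<Omega>" and tri: "triangle a\<^sub>0 b\<^sub>0 c\<^sub>0"
      by (auto simp: triangle_types_def)
    show "coherent_wrt \<SS> \<tau>"
      unfolding coherent_wrt_def
    proof (intro ballI)
      fix \<alpha> \<beta> \<gamma>
      assume cells: "\<alpha> \<in> \<SS>" "\<beta> \<in> \<SS>" "\<gamma> \<in> \<SS>"
      show "\<exists>p. \<forall>a\<in>\<alpha>. card {(b, c) \<in> \<beta> \<times> \<gamma>. (a, b, c) \<in> \<tau>} = p"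
      proof (cases "\<exists>a\<in>\<alpha>. \<exists>b\<in>\<beta>. \<exists>c\<in>\<gamma>. (a, b, c) \<in> \<tau>")
        case True
        then obtain a\<^sub>1 b\<^sub>1 c\<^sub>1 where in1: "a\<^sub>1 \<in> \<alpha>" "b\<^sub>1 \<in> \<beta>" "c\<^sub>1 \<in> \<gamma>" and t1: "(a\<^sub>1, b\<^sub>1, c\<^sub>1) \<in> \<tau>"
          by blast
        have "a\<^sub>1 \<subseteq> \<Omega>" "b\<^sub>1 \<subseteq> \<Omega>" "c\<^sub>1 \<subseteq> \<Omega>"
          using in1 cells sub by blast+
        from triple_type_triangle_iff[OF fin sub0 this tri] t1
        have c1: "card a\<^sub>1 = card a\<^sub>0" "card b\<^sub>1 = card b\<^sub>0" "card c\<^sub>1 = card c\<^sub>0"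
          by (simp_all add: \<tau>)
        have "{(b, c) \<in> \<beta> \<times> \<gamma>. (a, b, c) \<in> \<tau>} = triangle_pairs \<beta> \<gamma> a (card (b\<^sub>0 \<inter> c\<^sub>0 - a\<^sub>0))"
          if "a \<in> \<alpha>" for a
          unfolding \<tau>
        proof (rule pairs_eq[OF sub0 tri])
          show "a \<subseteq> \<Omega>" "\<beta> \<subseteq> Pow \<Omega>" "\<gamma> \<subseteq> Pow \<Omega>"
            using sub cells that by blast+
          show "card a = card a\<^sub>0" "\<forall>b\<in>\<beta>. card b = card b\<^sub>0" "\<forall>c\<in>\<gamma>. card c = card c\<^sub>0"
            using cell_card[OF cells(1) in1(1) c1(1)] cell_card[OF cells(2) in1(2) c1(2)]
              cell_card[OF cells(3) in1(3) c1(3)] that by simp_all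
        qed
        then show ?thesis
          using R cells by simp
      next
        case False
        then have empty: "{(b, c) \<in> \<beta> \<times> \<gamma>. (a, b, c) \<in> \<tau>} = {}" if "a \<in> \<alpha>" for a
          using that by auto
        show ?thesis
          by (intro exI[of _ 0] ballI) (simp only: empty card.empty)
      qed
    qed
  qed
qed

text \<open>
  A point of \<open>a\<close> lies in \<open>b\<close> only, in \<open>c\<close> only, or in both; another point lies in both or in
  neither. So there are at most three choices per point.
\<close>
lemma card_triangle_pairs_le:
  assumes fin: "finite \<Omega>" and "\<beta> \<subseteq> Pow \<Omega>" "\<gamma> \<subseteq> Pow \<Omega>"
  shows "card (triangle_pairs \<beta> \<gamma> a x) \<le> 3 ^ card \<Omega>"
proof -
  define M where "M i = (if i \<in> a then {(True, False), (False, True), (True, True)}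
    else {(False, False), (True, True)})" for i
  define f where "f = (\<lambda>(b, c). \<lambda>i\<in>\<Omega>. (i \<in> b, i \<in> c))"
  have finM: "finite (Pi\<^sub>E \<Omega> M)"
    using fin by (intro finite_PiE) (auto simp: M_def)
  have inj: "inj_on f (triangle_pairs \<beta> \<gamma> a x)"
  proof (rule inj_onI, clarify)
    fix b c b' c'
    assume in1: "(b, c) \<in> triangle_pairs \<beta> \<gamma> a x" and in2: "(b', c') \<in> triangle_pairs \<beta> \<gamma> a x"
      and eq: "f (b, c) = f (b', c')"
    have "b \<subseteq> \<Omega>" "c \<subseteq> \<Omega>" "b' \<subseteq> \<Omega>" "c' \<subseteq> \<Omega>"
      using in1 in2 assms by (auto simp: triangle_pairs_def)
    moreover have "(i \<in> b \<longleftrightarrow> i \<in> b') \<and> (i \<in> c \<longleftrightarrow> i \<in> c')" if "i \<in> \<Omega>" for i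
      using fun_cong[OF eq, of i] that by (simp add: f_def)
    ultimately show "b = b' \<and> c = c'"
      by blast
  qed
  have img: "f ` triangle_pairs \<beta> \<gamma> a x \<subseteq> Pi\<^sub>E \<Omega> M"
    by (auto simp: f_def M_def triangle_pairs_def triangle_def)
  have "card (triangle_pairs \<beta> \<gamma> a x) \<le> card (Pi\<^sub>E \<Omega> M)"
    by (rule card_inj_on_le[OF inj img finM])
  also have "\<dots> = (\<Prod>i\<in>\<Omega>. card (M i))"
    using fin by (simp add: card_PiE)
  also have "\<dots> \<le> (\<Prod>i\<in>\<Omega>. 3)"
    by (intro prod_mono) (auto simp: M_def)
  finally show ?thesis
    by simp
qed

section \<open>Intersection numbers as weighted counts of triangles\<close>

lemma card_two_step_words:
  assumes fin: "finite \<Omega>" and u: "u \<in> words m \<Omega>" and v: "v \<in> words m \<Omega>"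
    and \<beta>: "\<beta> \<subseteq> Pow \<Omega>" and \<gamma>: "\<gamma> \<subseteq> Pow \<Omega>"
    and a: "diff_set \<Omega> u v = a"
    and cards: "card a = k\<^sub>a" "\<And>b. b \<in> \<beta> \<Longrightarrow> card b = k\<^sub>b" "\<And>c. c \<in> \<gamma> \<Longrightarrow> card c = k\<^sub>c"
  defines "K \<equiv> k\<^sub>b + k\<^sub>c - k\<^sub>a"
  shows "card {w \<in> words m \<Omega>. (u, w) \<in> word_relation m \<Omega> \<beta> \<and> (w, v) \<in> word_relation m \<Omega> \<gamma>} =
    (\<Sum>x\<le>K div 2. card (triangle_pairs \<beta> \<gamma> a x) * ((m - 1) ^ x * (m - 2) ^ (K - 2 * x)))"
proof -
  let ?W = "\<lambda>(b, c). {w \<in> words m \<Omega>. diff_set \<Omega> u w = b \<and> diff_set \<Omega> w v = c}"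
  let ?T = "{(b, c) \<in> \<beta> \<times> \<gamma>. triangle a b c}"
  let ?f = "\<lambda>(b, c). card (b \<inter> c - a)"
  have fin\<beta>\<gamma>: "finite (\<beta> \<times> \<gamma>)"
    using fin \<beta> \<gamma> by (meson finite_Pow_iff finite_SigmaI finite_subset)
  have finT: "finite ?T"
    by (rule finite_subset[OF _ fin\<beta>\<gamma>]) auto
  have tri: "card (b \<inter> c - a) \<le> K div 2 \<and> card (a \<inter> b \<inter> c) = K - 2 * card (b \<inter> c - a)"
    if bc: "b \<in> \<beta>" "c \<in> \<gamma>" and t: "triangle a b c" for b c
  proof -
    have "finite a" "finite b" "finite c"
      using fin bc \<beta> \<gamma> a diff_set_subset[of \<Omega> u v] by (auto intro: finite_subset[OF _ fin])
    from card_triangle_sides[OF this t] have "K = card (a \<inter> b \<inter> c) + 2 * card (b \<inter> c - a)"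
      using cards bc by (simp add: K_def)
    then show ?thesis
      by linarith
  qed
  have "{w \<in> words m \<Omega>. (u, w) \<in> word_relation m \<Omega> \<beta> \<and> (w, v) \<in> word_relation m \<Omega> \<gamma>} = (\<Union>z\<in>\<beta> \<times> \<gamma>. ?W z)"
    using u v by (auto simp: word_relation_def)
  then have "card {w \<in> words m \<Omega>. (u, w) \<in> word_relation m \<Omega> \<beta> \<and> (w, v) \<in> word_relation m \<Omega> \<gamma>}
      = card (\<Union>z\<in>\<beta> \<times> \<gamma>. ?W z)"
    by simp
  also have "\<dots> = (\<Sum>z\<in>\<beta> \<times> \<gamma>. card (?W z))"
    using fin\<beta>\<gamma> finite_words[OF fin] by (intro card_UN_disjoint) auto
  also have "\<dots> = (\<Sum>(b, c)\<in>\<beta> \<times> \<gamma>. if triangle a b c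
      then (m - 1) ^ card (b \<inter> c - a) * (m - 2) ^ card (a \<inter> b \<inter> c) else 0)"
    using card_intermediate_words[OF fin u v, unfolded a] subsetD[OF \<beta>] subsetD[OF \<gamma>]
    by (intro sum.cong) auto
  also have "\<dots> = (\<Sum>(b, c)\<in>?T. (m - 1) ^ card (b \<inter> c - a) * (m - 2) ^ card (a \<inter> b \<inter> c))"
    using fin\<beta>\<gamma> by (intro sum.mono_neutral_cong_right) (auto split: if_splits)
  also have "\<dots> = (\<Sum>z\<in>?T. (m - 1) ^ ?f z * (m - 2) ^ (K - 2 * ?f z))"
    using tri by (intro sum.cong) auto
  also have "\<dots> = (\<Sum>x\<le>K div 2. \<Sum>z\<in>{z \<in> ?T. ?f z = x}. (m - 1) ^ ?f z * (m - 2) ^ (K - 2 * ?f z))"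
    using finT tri by (intro sum.group[symmetric]) auto
  also have "\<dots> = (\<Sum>x\<le>K div 2. card (triangle_pairs \<beta> \<gamma> a x) * ((m - 1) ^ x * (m - 2) ^ (K - 2 * x)))"
  proof (intro sum.cong refl)
    fix x
    have "{z \<in> ?T. ?f z = x} = triangle_pairs \<beta> \<gamma> a x"
      by (auto simp: triangle_pairs_def)
    moreover have "(\<Sum>z\<in>{z \<in> ?T. ?f z = x}. (m - 1) ^ ?f z * (m - 2) ^ (K - 2 * ?f z))
        = (\<Sum>z\<in>{z \<in> ?T. ?f z = x}. (m - 1) ^ x * (m - 2) ^ (K - 2 * x))"
      by (intro sum.cong) auto
    ultimately show "(\<Sum>z\<in>{z \<in> ?T. ?f z = x}. (m - 1) ^ ?f z * (m - 2) ^ (K - 2 * ?f z))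
        = card (triangle_pairs \<beta> \<gamma> a x) * ((m - 1) ^ x * (m - 2) ^ (K - 2 * x))"
      by simp
  qed
  finally show ?thesis .
qed

text \<open>
  A base expansion in two coprime bases is unique as long as its digits are small: modulo \<open>A\<close> only the
  term \<open>x = 0\<close> survives, so \<open>A\<close> divides \<open>D 0\<close>. Then \<open>D 0 = 0\<close>, and one divides by \<open>A\<close> and repeats.
\<close>
lemma small_coefficients_vanish:
  fixes A B :: int and D :: "nat \<Rightarrow> int"
  assumes cop: "coprime A B"
  shows "\<lbrakk>\<And>x. \<bar>D x\<bar> < A; (\<Sum>x\<le>n. D x * (A ^ x * B ^ (n - x))) = 0; x \<le> n\<rbrakk> \<Longrightarrow> D x = 0"
proof (induction n arbitrary: D x)
  case 0
  then show ?case
    by simp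
next
  case (Suc n)
  let ?S = "\<Sum>x\<le>n. D (Suc x) * (A ^ x * B ^ (n - x))"
  have "(\<Sum>x\<le>Suc n. D x * (A ^ x * B ^ (Suc n - x))) = D 0 * B ^ Suc n + A * ?S"
    by (subst sum.atMost_Suc_shift) (simp add: sum_distrib_left mult_ac)
  then have split: "D 0 * B ^ Suc n + A * ?S = 0"
    using Suc.prems(2) by simp
  then have "D 0 * B ^ Suc n = A * (- ?S)"
    by linarith
  then have "A dvd D 0 * B ^ Suc n"
    by (metis dvd_triv_left)
  then have "A dvd D 0"
    using cop by (simp add: coprime_dvd_mult_left_iff)
  then have D0: "D 0 = 0"
    using Suc.prems(1)[of 0] by (metis abs_of_nonneg abs_ge_zero dvd_abs_iff not_less zdvd_imp_le zero_less_abs_iff)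
  have "A > 0"
    using Suc.prems(1)[of 0] by linarith
  then have "?S = 0"
    using split D0 by simp
  then have "D (Suc y) = 0" if "y \<le> n" for y
    using Suc.IH[of "\<lambda>x. D (Suc x)" y] Suc.prems(1) that by simp
  with D0 Suc.prems(3) show ?case
    by (cases x) auto
qed

text \<open>
  The exponents \<open>K - 2 * x\<close> all have the parity of \<open>K\<close>. After removal of the common factor
  \<open>(m - 2) ^ (K mod 2)\<close> the sum is homogeneous in \<open>m - 1\<close> and \<open>(m - 2)\<^sup>2\<close>.
\<close>
lemma weighted_count_determines_coefficients:
  fixes N N' :: "nat \<Rightarrow> nat"
  assumes m: "m \<ge> 3" and bound: "\<And>x. N x < m - 1" "\<And>x. N' x < m - 1"
    and eq: "(\<Sum>x\<le>K div 2. N x * ((m - 1) ^ x * (m - 2) ^ (K - 2 * x))) =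
      (\<Sum>x\<le>K div 2. N' x * ((m - 1) ^ x * (m - 2) ^ (K - 2 * x)))"
    and x: "x \<le> K div 2"
  shows "N x = N' x"
proof -
  define n where "n = K div 2"
  define A B where "A = int m - 1" and "B = int m - 2"
  define D where "D x = int (N x) - int (N' x)" for x
  have weight: "int ((m - 1) ^ x * (m - 2) ^ (K - 2 * x)) = B ^ (K mod 2) * (A ^ x * (B\<^sup>2) ^ (n - x))"
    if "x \<le> n" for x
  proof -
    have "K - 2 * x = K mod 2 + 2 * (n - x)"
      using that unfolding n_def by presburger
    then have "B ^ (K - 2 * x) = B ^ (K mod 2) * (B\<^sup>2) ^ (n - x)"
      by (simp add: power_add power_mult)
    then show ?thesis
      using m by (simp add: A_def B_def of_nat_diff)
  qed
  have int_sum: "int (\<Sum>x\<le>n. M x * ((m - 1) ^ x * (m - 2) ^ (K - 2 * x)))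
      = B ^ (K mod 2) * (\<Sum>x\<le>n. int (M x) * (A ^ x * (B\<^sup>2) ^ (n - x)))" for M :: "nat \<Rightarrow> nat"
    unfolding sum_distrib_left of_nat_sum
  proof (intro sum.cong refl)
    fix x assume "x \<in> {..n}"
    then show "int (M x * ((m - 1) ^ x * (m - 2) ^ (K - 2 * x))) =
        B ^ (K mod 2) * (int (M x) * (A ^ x * (B\<^sup>2) ^ (n - x)))"
      using weight[of x] by (simp only: of_nat_mult[of "M x"]) simp
  qed
  have "B ^ (K mod 2) * (\<Sum>x\<le>n. int (N x) * (A ^ x * (B\<^sup>2) ^ (n - x)))
      = B ^ (K mod 2) * (\<Sum>x\<le>n. int (N' x) * (A ^ x * (B\<^sup>2) ^ (n - x)))"
    using arg_cong[OF eq[folded n_def], of int] by (simp only: int_sum)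
  moreover have "B \<noteq> 0"
    using m by (simp add: B_def)
  ultimately have "(\<Sum>x\<le>n. D x * (A ^ x * (B\<^sup>2) ^ (n - x))) = 0"
    by (simp add: D_def left_diff_distrib sum_subtractf)
  moreover have "coprime A (B\<^sup>2)"
  proof -
    have "A = B + 1"
      by (simp add: A_def B_def)
    then show ?thesis
      by simp
  qed
  moreover have "\<bar>D x\<bar> < A" for x
    using bound[of x] m by (simp add: D_def A_def of_nat_diff)
  ultimately have "D x = 0"
    using x by (intro small_coefficients_vanish[of A "B\<^sup>2" D n x]) (auto simp: n_def)
  then show ?thesis
    by (simp add: D_def)
qed

section \<open>The correspondence between partitions\<close>

lemma partition_on_fibers: "partition_on A (fibers A f)"
  by (rule partition_onI) (auto simp: fibers_def disjnt_def)

lemma mem_cells_eq: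
  assumes "partition_on A P" "X \<in> P" "Y \<in> P" "z \<in> X" "z \<in> Y"
  shows "X = Y"
  using assms partition_onD2[OF assms(1)] by (meson disjointD disjoint_iff)

lemma partition_on_word_partition:
  assumes "partition_on (Pow \<Omega>) \<SS>"
  shows "partition_on (words m \<Omega> \<times> words m \<Omega>) (word_partition m \<Omega> \<SS>)"
proof (rule partition_onI)
  show "\<Union> (word_partition m \<Omega> \<SS>) = words m \<Omega> \<times> words m \<Omega>"
  proof (intro equalityI subsetI)
    fix z assume "z \<in> words m \<Omega> \<times> words m \<Omega>"
    then obtain u v where z: "z = (u, v)" "u \<in> words m \<Omega>" "v \<in> words m \<Omega>"
      by blast
    obtain \<alpha> where "\<alpha> \<in> \<SS>" "diff_set \<Omega> u v \<in> \<alpha>"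
      using partition_onD1[OF assms] diff_set_subset[of \<Omega> u v] by blast
    moreover from this z have "z \<in> word_relation m \<Omega> \<alpha>"
      by (simp add: word_relation_def)
    ultimately show "z \<in> \<Union> (word_partition m \<Omega> \<SS>)"
      unfolding word_partition_eq by blast
  qed (auto simp: word_partition_eq word_relation_def)
next
  fix R S
  assume "R \<in> word_partition m \<Omega> \<SS>" "S \<in> word_partition m \<Omega> \<SS>" "R \<noteq> S"
  then obtain \<alpha> \<beta> where R: "R = word_relation m \<Omega> \<alpha>" "\<alpha> \<in> \<SS>" and S: "S = word_relation m \<Omega> \<beta>" "\<beta> \<in> \<SS>"
    and "\<alpha> \<noteq> \<beta>"
    by (auto simp: word_partition_eq)
  then have "\<alpha> \<inter> \<beta> = {}"
    using mem_cells_eq[OF assms, of \<alpha> \<beta>] by blast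
  then show "disjnt R S"
    by (auto simp: R S word_relation_def disjnt_def)
qed (auto simp: word_partition_eq)

lemma sym_word_relation: "sym (word_relation m \<Omega> \<alpha>)"
  by (auto simp: sym_def word_relation_def diff_set_commute)

lemma association_scheme_word_partition:
  assumes m: "m \<ge> 1" and \<SS>: "set_association_scheme \<Omega> \<SS>"
  shows "association_scheme (words m \<Omega>) (word_partition m \<Omega> \<SS>)"
proof -
  have fin: "finite \<Omega>" and part: "partition_on (Pow \<Omega>) \<SS>"
    and unif: "\<forall>\<alpha>\<in>\<SS>. \<forall>a\<in>\<alpha>. \<forall>b\<in>\<alpha>. card a = card b"
    and coh: "\<forall>\<tau>\<in>triangle_types \<Omega>. coherent_wrt \<SS> \<tau>"
    using \<SS> unfolding set_association_scheme_def by blast+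
  have sub: "\<alpha> \<subseteq> Pow \<Omega>" if "\<alpha> \<in> \<SS>" for \<alpha>
    using partition_onD1[OF part] that by blast
  let ?V = "words m \<Omega>" and ?X = "word_partition m \<Omega> \<SS>"
  have sym: "sym R" if "R \<in> ?X" for R
    using that by (auto simp: word_partition_eq sym_word_relation)
  \<comment> \<open>As sets in a cell are equally large, the cell of the empty set is a singleton; its relation
    is the diagonal.\<close>
  have diag: "Id_on ?V \<in> ?X"
  proof -
    have "{} \<in> \<Union> \<SS>"
      unfolding partition_onD1[OF part, symmetric] by simp
    then obtain \<alpha> where \<alpha>: "\<alpha> \<in> \<SS>" "{} \<in> \<alpha>"
      by blast
    have "a = {}" if "a \<in> \<alpha>" for a
    proof -
      have "card a = 0"
        using bspec[OF bspec[OF bspec[OF unif \<alpha>(1)] that] \<alpha>(2)] by simp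
      moreover have "finite a"
        using sub[OF \<alpha>(1)] that fin by (auto intro: finite_subset)
      ultimately show ?thesis
        by simp
    qed
    then have "\<alpha> = {{}}"
      using \<alpha>(2) by blast
    moreover have "(u, v) \<in> word_relation m \<Omega> {{}} \<longleftrightarrow> (u, v) \<in> Id_on ?V" for u v
      using diff_set_empty_iff[of u m \<Omega> v] by (auto simp: word_relation_def)
    ultimately have "word_relation m \<Omega> \<alpha> = Id_on ?V"
      by auto
    moreover have "Id_on ?V \<noteq> {}"
      using words_nonempty[OF m, of \<Omega>] by auto
    ultimately show ?thesis
      using \<alpha>(1) by (auto simp: word_partition_eq)
  qed
  have conf: "configuration ?V ?X"
    unfolding configuration_def
  proof (intro conjI)
    have "partition_on (Id_on ?V) {Id_on ?V}"
      using words_nonempty[OF m, of \<Omega>] by (auto simp: partition_on_def)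
    then show "\<exists>\<DD>\<subseteq>?X. partition_on (Id_on ?V) \<DD>"
      using diag by blast
    show "\<forall>R\<in>?X. R\<inverse> \<in> ?X"
      using sym by (simp add: sym_conv_converse_eq)
  qed (use fin part in \<open>auto simp: finite_words partition_on_word_partition\<close>)
  have "\<exists>p. \<forall>(u, v)\<in>R. card {w \<in> ?V. (u, w) \<in> S \<and> (w, v) \<in> T} = p"
    if "R \<in> ?X" "S \<in> ?X" "T \<in> ?X" for R S T
  proof -
    obtain \<alpha> \<beta> \<gamma> where cells: "\<alpha> \<in> \<SS>" "\<beta> \<in> \<SS>" "\<gamma> \<in> \<SS>" and R: "R = word_relation m \<Omega> \<alpha>"
      and S: "S = word_relation m \<Omega> \<beta>" and T: "T = word_relation m \<Omega> \<gamma>"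
      using \<open>R \<in> ?X\<close> \<open>S \<in> ?X\<close> \<open>T \<in> ?X\<close> by (auto simp: word_partition_eq)
    have "\<exists>k. \<forall>a\<in>\<delta>. card a = k" if "\<delta> \<in> \<SS>" for \<delta>
      using unif that by blast
    then obtain k\<^sub>a k\<^sub>b k\<^sub>c where cards: "\<And>a. a \<in> \<alpha> \<Longrightarrow> card a = k\<^sub>a" "\<And>b. b \<in> \<beta> \<Longrightarrow> card b = k\<^sub>b"
        "\<And>c. c \<in> \<gamma> \<Longrightarrow> card c = k\<^sub>c"
      using cells by meson
    have "\<forall>x. \<exists>p. \<forall>a\<in>\<alpha>. card (triangle_pairs \<beta> \<gamma> a x) = p"
      using coh coherent_wrt_triangle_types_iff[OF fin sub unif] cells by blast
    then obtain N where N: "\<And>x a. a \<in> \<alpha> \<Longrightarrow> card (triangle_pairs \<beta> \<gamma> a x) = N x"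
      by metis
    have "card {w \<in> ?V. (u, w) \<in> S \<and> (w, v) \<in> T} =
        (\<Sum>x\<le>(k\<^sub>b + k\<^sub>c - k\<^sub>a) div 2. N x * ((m - 1) ^ x * (m - 2) ^ (k\<^sub>b + k\<^sub>c - k\<^sub>a - 2 * x)))"
      if "(u, v) \<in> R" for u v
    proof -
      have uv: "u \<in> ?V" "v \<in> ?V" and a: "diff_set \<Omega> u v \<in> \<alpha>"
        using that by (auto simp: R word_relation_def)
      show ?thesis
        unfolding S T
        using card_two_step_words[OF fin uv sub[OF cells(2)] sub[OF cells(3)] refl cards(1)[OF a] cards(2,3)]
        by (simp add: N[OF a])
    qed
    then show ?thesis
      by blast
  qed
  then show ?thesis
    using conf diag sym by (auto simp: association_scheme_def coherent_configuration_def)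
qed

lemma refines_word_partition:
  assumes part: "partition_on (Pow \<Omega>) \<SS>"
  shows "refines (words m \<Omega> \<times> words m \<Omega>)
    (fibers (words m \<Omega> \<times> words m \<Omega>) (\<lambda>(u, v). diff_set \<Omega> u v)) (word_partition m \<Omega> \<SS>)"
  unfolding refines_def
proof (intro conjI ballI partition_on_fibers partition_on_word_partition part)
  fix F assume "F \<in> fibers (words m \<Omega> \<times> words m \<Omega>) (\<lambda>(u, v). diff_set \<Omega> u v)"
  then obtain u v where uv: "u \<in> words m \<Omega>" "v \<in> words m \<Omega>"
    and F: "F = {(u', v') \<in> words m \<Omega> \<times> words m \<Omega>. diff_set \<Omega> u' v' = diff_set \<Omega> u v}"
    by (auto simp: fibers_def)
  obtain \<alpha> where \<alpha>: "\<alpha> \<in> \<SS>" "diff_set \<Omega> u v \<in> \<alpha>"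
    using partition_onD1[OF part] diff_set_subset[of \<Omega> u v] by blast
  then have "F \<subseteq> word_relation m \<Omega> \<alpha>" "(u, v) \<in> word_relation m \<Omega> \<alpha>"
    using uv by (auto simp: F word_relation_def)
  then show "\<exists>R\<in>word_partition m \<Omega> \<SS>. F \<subseteq> R"
    using \<alpha>(1) by (auto simp: word_partition_eq)
qed

lemma word_partition_refines:
  assumes part: "partition_on (Pow \<Omega>) \<SS>" and unif: "\<forall>\<alpha>\<in>\<SS>. \<forall>a\<in>\<alpha>. \<forall>b\<in>\<alpha>. card a = card b"
  shows "refines (words m \<Omega> \<times> words m \<Omega>) (word_partition m \<Omega> \<SS>)
    (fibers (words m \<Omega> \<times> words m \<Omega>) (\<lambda>(u, v). card (diff_set \<Omega> u v)))"
  unfolding refines_def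
proof (intro conjI ballI partition_on_fibers partition_on_word_partition part)
  fix R assume "R \<in> word_partition m \<Omega> \<SS>"
  then obtain \<alpha> u v where \<alpha>: "\<alpha> \<in> \<SS>" "R = word_relation m \<Omega> \<alpha>" and uv: "(u, v) \<in> R"
    by (auto simp: word_partition_eq)
  have "R \<subseteq> {z \<in> words m \<Omega> \<times> words m \<Omega>.
      (\<lambda>(u, v). card (diff_set \<Omega> u v)) z = (\<lambda>(u, v). card (diff_set \<Omega> u v)) (u, v)}"
    using uv \<alpha> unif by (auto simp: word_relation_def)
  moreover have "(u, v) \<in> words m \<Omega> \<times> words m \<Omega>"
    using uv \<alpha>(2) by (auto simp: word_relation_def)
  ultimately show "\<exists>F\<in>fibers (words m \<Omega> \<times> words m \<Omega>) (\<lambda>(u, v). card (diff_set \<Omega> u v)). R \<subseteq> F"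
    unfolding fibers_def by blast
qed

text \<open>
  Each relation is a union of fibres of the difference set, so it is recovered from the difference
  sets of its pairs. These form a partition of the whole power set since two letters suffice to
  realise every subset as a difference set.
\<close>
lemma refined_scheme_eq_word_partition:
  assumes m: "m \<ge> 2"
    and ref: "refines (words m \<Omega> \<times> words m \<Omega>)
      (fibers (words m \<Omega> \<times> words m \<Omega>) (\<lambda>(u, v). diff_set \<Omega> u v)) \<XX>"
  obtains \<SS> where "partition_on (Pow \<Omega>) \<SS>" "\<XX> = word_partition m \<Omega> \<SS>"
proof -
  let ?V = "words m \<Omega>" and ?\<delta> = "\<lambda>(u, v). diff_set \<Omega> u v"
  have part: "partition_on (?V \<times> ?V) \<XX>"
    using ref by (simp add: refines_def)
  have subV: "R \<subseteq> ?V \<times> ?V" if "R \<in> \<XX>" for R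
    using partition_onD1[OF part] that by blast
  have closed: "(u', v') \<in> R" if R: "R \<in> \<XX>" "(u, v) \<in> R"
    and uv': "u' \<in> ?V" "v' \<in> ?V" "diff_set \<Omega> u' v' = diff_set \<Omega> u v" for R u v u' v'
  proof -
    let ?F = "{z \<in> ?V \<times> ?V. ?\<delta> z = ?\<delta> (u, v)}"
    have uv: "(u, v) \<in> ?V \<times> ?V"
      using subV R by blast
    then have "?F \<in> fibers (?V \<times> ?V) ?\<delta>"
      unfolding fibers_def by blast
    then obtain S where S: "S \<in> \<XX>" "?F \<subseteq> S"
      using ref unfolding refines_def by blast
    then have "(u, v) \<in> S" "(u', v') \<in> S"
      using uv uv' by auto
    then show ?thesis
      using mem_cells_eq[OF part S(1) R(1)] R(2) by blast
  qed
  have rel: "word_relation m \<Omega> (?\<delta> ` R) = R" if "R \<in> \<XX>" for R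
    using closed[OF that] subV[OF that] by (fastforce simp: word_relation_def)
  let ?S = "(\<lambda>R. ?\<delta> ` R) ` \<XX>"
  have "\<XX> = word_partition m \<Omega> ?S"
    using rel partition_onD3[OF part] by (force simp: word_partition_eq image_image)
  moreover have "partition_on (Pow \<Omega>) ?S"
  proof (rule partition_onI)
    show "\<Union> ?S = Pow \<Omega>"
    proof
      show "\<Union> ?S \<subseteq> Pow \<Omega>"
        using diff_set_subset by fastforce
      show "Pow \<Omega> \<subseteq> \<Union> ?S"
      proof
        fix a assume "a \<in> Pow \<Omega>"
        then obtain u v where uv: "u \<in> ?V" "v \<in> ?V" "diff_set \<Omega> u v = a"
          using exists_words_with_diff_set[OF m] by blast
        then obtain R where "R \<in> \<XX>" "(u, v) \<in> R"
          using partition_onD1[OF part] by blast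
        then show "a \<in> \<Union> ?S"
          using uv(3) by force
      qed
    qed
    show "disjnt \<alpha> \<beta>" if "\<alpha> \<in> ?S" "\<beta> \<in> ?S" "\<alpha> \<noteq> \<beta>" for \<alpha> \<beta>
    proof (rule ccontr)
      assume "\<not> disjnt \<alpha> \<beta>"
      with that obtain R S u v u' v' where R: "R \<in> \<XX>" "\<alpha> = ?\<delta> ` R" "(u, v) \<in> R"
        and S: "S \<in> \<XX>" "\<beta> = ?\<delta> ` S" "(u', v') \<in> S" and "diff_set \<Omega> u v = diff_set \<Omega> u' v'"
        unfolding disjnt_def by fastforce
      then have "(u, v) \<in> S"
        using subV[OF R(1)] closed[OF S(1,3)] by blast
      then have "R = S"
        using mem_cells_eq[OF part] R S by blast
      with that(3) R S show False
        by simp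
    qed
    show "{} \<notin> ?S"
      using partition_onD3[OF part] by auto
  qed
  ultimately show thesis
    using that by blast
qed

text \<open>
  The bound on \<open>m\<close> makes the number of triangles through a given set, at most \<open>3 ^ card \<Omega>\<close>, smaller
  than \<open>m - 1\<close>, so that intersection numbers determine the number of triangles for each parameter.
\<close>
lemma set_association_scheme_of_word_partition:
  assumes fin: "finite \<Omega>" and m: "m \<ge> 3 ^ card \<Omega> + 2" and part: "partition_on (Pow \<Omega>) \<SS>"
    and scheme: "coherent_configuration (words m \<Omega>) (word_partition m \<Omega> \<SS>)"
    and ref: "refines (words m \<Omega> \<times> words m \<Omega>) (word_partition m \<Omega> \<SS>)
      (fibers (words m \<Omega> \<times> words m \<Omega>) (\<lambda>(u, v). card (diff_set \<Omega> u v)))"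
  shows "set_association_scheme \<Omega> \<SS>"
proof -
  let ?V = "words m \<Omega>"
  have "(3::nat) ^ card \<Omega> \<ge> 1"
    by simp
  with m have m3: "m \<ge> 3"
    by linarith
  have sub: "\<alpha> \<subseteq> Pow \<Omega>" if "\<alpha> \<in> \<SS>" for \<alpha>
    using partition_onD1[OF part] that by blast
  have realise: "\<exists>u v. (u, v) \<in> word_relation m \<Omega> \<alpha> \<and> diff_set \<Omega> u v = a" if "\<alpha> \<in> \<SS>" "a \<in> \<alpha>" for \<alpha> a
  proof -
    have "a \<subseteq> \<Omega>"
      using sub that by blast
    then obtain u v where "u \<in> ?V" "v \<in> ?V" "diff_set \<Omega> u v = a"
      using exists_words_with_diff_set[of m a \<Omega>] m3 by auto
    then show ?thesis
      using that by (auto simp: word_relation_def)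
  qed
  have rel_in: "word_relation m \<Omega> \<alpha> \<in> word_partition m \<Omega> \<SS>" if "\<alpha> \<in> \<SS>" for \<alpha>
  proof -
    have "\<alpha> \<noteq> {}"
      using that partition_onD3[OF part] by auto
    then obtain a where "a \<in> \<alpha>"
      by blast
    then show ?thesis
      using realise[OF that] that by (fastforce simp: word_partition_eq)
  qed
  have unif: "\<forall>\<alpha>\<in>\<SS>. \<forall>a\<in>\<alpha>. \<forall>b\<in>\<alpha>. card a = card b"
  proof (intro ballI)
    fix \<alpha> a b assume \<alpha>: "\<alpha> \<in> \<SS>" and ab: "a \<in> \<alpha>" "b \<in> \<alpha>"
    obtain F where F: "F \<in> fibers (?V \<times> ?V) (\<lambda>(u, v). card (diff_set \<Omega> u v))" "word_relation m \<Omega> \<alpha> \<subseteq> F"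
      using ref rel_in[OF \<alpha>] unfolding refines_def by blast
    from realise[OF \<alpha> ab(1)] realise[OF \<alpha> ab(2)] F(2)
    obtain u v u' v' where "(u, v) \<in> F" "diff_set \<Omega> u v = a" "(u', v') \<in> F" "diff_set \<Omega> u' v' = b"
      by blast
    with F(1) show "card a = card b"
      by (auto simp: fibers_def)
  qed
  have "\<exists>p. \<forall>a\<in>\<alpha>. card (triangle_pairs \<beta> \<gamma> a x) = p"
    if cells: "\<alpha> \<in> \<SS>" "\<beta> \<in> \<SS>" "\<gamma> \<in> \<SS>" for \<alpha> \<beta> \<gamma> x
  proof -
    let ?R = "word_relation m \<Omega>"
    have "\<exists>k. \<forall>a\<in>\<delta>. card a = k" if "\<delta> \<in> \<SS>" for \<delta>
      using unif that by blast
    then obtain k\<^sub>a k\<^sub>b k\<^sub>c where cards: "\<And>a. a \<in> \<alpha> \<Longrightarrow> card a = k\<^sub>a" "\<And>b. b \<in> \<beta> \<Longrightarrow> card b = k\<^sub>b"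
        "\<And>c. c \<in> \<gamma> \<Longrightarrow> card c = k\<^sub>c"
      using cells by meson
    define K where "K = k\<^sub>b + k\<^sub>c - k\<^sub>a"
    have "\<exists>p. \<forall>(u, v)\<in>?R \<alpha>. card {w \<in> ?V. (u, w) \<in> ?R \<beta> \<and> (w, v) \<in> ?R \<gamma>} = p"
      using scheme rel_in[OF cells(1)] rel_in[OF cells(2)] rel_in[OF cells(3)]
      unfolding coherent_configuration_def by meson
    then obtain p where p: "\<And>u v. (u, v) \<in> ?R \<alpha> \<Longrightarrow> card {w \<in> ?V. (u, w) \<in> ?R \<beta> \<and> (w, v) \<in> ?R \<gamma>} = p"
      by auto
    have sum_p: "(\<Sum>x\<le>K div 2. card (triangle_pairs \<beta> \<gamma> a x) * ((m - 1) ^ x * (m - 2) ^ (K - 2 * x))) = p"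
      if a: "a \<in> \<alpha>" for a
    proof -
      obtain u v where uv: "(u, v) \<in> ?R \<alpha>" "diff_set \<Omega> u v = a"
        using realise[OF cells(1) a] by blast
      then have "u \<in> ?V" "v \<in> ?V"
        by (auto simp: word_relation_def)
      from card_two_step_words[OF fin this sub[OF cells(2)] sub[OF cells(3)] uv(2) cards(1)[OF a] cards(2,3)]
      show ?thesis
        using p[OF uv(1)] by (simp add: K_def)
    qed
    have bound: "card (triangle_pairs \<beta> \<gamma> a x) < m - 1" for a x
      using card_triangle_pairs_le[OF fin sub[OF cells(2)] sub[OF cells(3)], of a x] m by linarith
    have "card (triangle_pairs \<beta> \<gamma> a x) = card (triangle_pairs \<beta> \<gamma> a' x)"
      if a: "a \<in> \<alpha>" "a' \<in> \<alpha>" for a a'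
    proof (cases "x \<le> K div 2")
      case True
      show ?thesis
        by (rule weighted_count_determines_coefficients[OF m3 bound bound
              trans[OF sum_p[OF a(1)] sum_p[OF a(2), symmetric]] True])
    next
      case False
      \<comment> \<open>No triangle has such a parameter, as \<open>K - 2 * x\<close> would be the size of \<open>a \<inter> b \<inter> c\<close>.\<close>
      have "triangle_pairs \<beta> \<gamma> a x = {}" if a: "a \<in> \<alpha>" for a
      proof -
        have False if t: "(b, c) \<in> triangle_pairs \<beta> \<gamma> a x" for b c
        proof -
          have bc: "b \<in> \<beta>" "c \<in> \<gamma>" "triangle a b c" "card (b \<inter> c - a) = x"
            using t by (auto simp: triangle_pairs_def)
          have "finite a" "finite b" "finite c"
            using a bc cells sub fin by (meson PowD finite_subset subsetD)+
          from card_triangle_sides[OF this bc(3)] have "K = card (a \<inter> b \<inter> c) + 2 * x"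
            using cards a bc by (simp add: K_def)
          with False show False
            by linarith
        qed
        then show ?thesis
          by auto
      qed
      then show ?thesis
        using a by simp
    qed
    then show ?thesis
      by blast
  qed
  then have "\<forall>\<tau>\<in>triangle_types \<Omega>. coherent_wrt \<SS> \<tau>"
    using coherent_wrt_triangle_types_iff[OF fin sub unif] by blast
  then show ?thesis
    unfolding set_association_scheme_def using fin part unif by blast
qed

theorem proposition2p3:
  fixes m d :: nat
  assumes "m \<ge> 1" and "d \<ge> 1"
  defines "V \<equiv> words m {1..d}"
  shows "(\<forall>\<SS>. set_association_scheme {1..d} \<SS> \<longrightarrow>
            association_scheme V (word_partition m {1..d} \<SS>) \<and>
            refines (V \<times> V) (trivial_power m d) (word_partition m {1..d} \<SS>) \<and>
            refines (V \<times> V) (word_partition m {1..d} \<SS>) (hamming_scheme d m))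
       \<and> (\<forall>\<XX>. association_scheme V \<XX> \<and>
            refines (V \<times> V) (trivial_power m d) \<XX> \<and>
            refines (V \<times> V) \<XX> (hamming_scheme d m) \<and>
            m \<ge> 3 ^ d + 4 \<longrightarrow>
            (\<exists>\<SS>. set_association_scheme {1..d} \<SS> \<and> \<XX> = word_partition m {1..d} \<SS>))"
proof (intro conjI allI impI)
  fix \<SS> assume \<SS>: "set_association_scheme {1..d} \<SS>"
  then show "association_scheme V (word_partition m {1..d} \<SS>)"
    unfolding V_def by (rule association_scheme_word_partition[OF assms(1)])
  have part: "partition_on (Pow {1..d}) \<SS>"
    and unif: "\<forall>\<alpha>\<in>\<SS>. \<forall>a\<in>\<alpha>. \<forall>b\<in>\<alpha>. card a = card b"
    using \<SS> unfolding set_association_scheme_def by blast+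
  show "refines (V \<times> V) (trivial_power m d) (word_partition m {1..d} \<SS>)"
    unfolding V_def trivial_power_def by (rule refines_word_partition[OF part])
  show "refines (V \<times> V) (word_partition m {1..d} \<SS>) (hamming_scheme d m)"
    unfolding V_def hamming_scheme_def by (rule word_partition_refines[OF part unif])
next
  fix \<XX> assume \<XX>: "association_scheme V \<XX> \<and> refines (V \<times> V) (trivial_power m d) \<XX> \<and>
      refines (V \<times> V) \<XX> (hamming_scheme d m) \<and> m \<ge> 3 ^ d + 4"
  then have "m \<ge> 2"
    by linarith
  then obtain \<SS> where \<SS>: "partition_on (Pow {1..d}) \<SS>" "\<XX> = word_partition m {1..d} \<SS>"
    using \<XX> unfolding V_def trivial_power_def by (elim refined_scheme_eq_word_partition) auto
  have "set_association_scheme {1..d} \<SS>"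
  proof (rule set_association_scheme_of_word_partition[OF _ _ \<SS>(1)])
    show "m \<ge> 3 ^ card {1..d} + 2"
      using \<XX> by simp
    show "coherent_configuration (words m {1..d}) (word_partition m {1..d} \<SS>)"
      using \<XX> \<SS>(2) by (simp add: association_scheme_def V_def)
  qed (use \<XX> \<SS>(2) in \<open>simp_all add: V_def hamming_scheme_def\<close>)
  then show "\<exists>\<SS>. set_association_scheme {1..d} \<SS> \<and> \<XX> = word_partition m {1..d} \<SS>"
    using \<SS>(2) by blast
qed

end
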